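(* Let $T$ be a linear operator acting on a complex Hilbert space $\mathcal{H}$ with $\|T\| \le 1$. Let $x \in \mathcal{H}$ and, for $n\ge 1$, denote $S_n(T) x := x + Tx + \dots + T^{n-1}x$. Suppose that $$\sum_{k=0}^\infty k\, \| T^{*k} x \| < \infty ,$$ $$\|S_n(T)x\| = o(\sqrt{n}) \quad (n\to \infty),$$ and $$\sum_{k=1}^{\infty} \frac{\|S_k(T)x\|^2 - \|TS_k(T)x\|^2}{k} < \infty .$$ Then there exists $y \in \mathcal{H}$ such that $x = (I-T)y$ and $\|Ty\| = \|y\|$.
   Context: $T^*$ is the Hilbert space adjoint of $T$, $T^{*k}=(T^* )^k$, and $I$ is the identity operator. *)

theory Defs
  imports "HOL-Analysis.Analysis" "HOL-Library.Landau_Symbols"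
begin

text \<open>
  The real inner product inherited from \<^class>\<open>real_inner\<close> is forced to be the real part of the
  complex one, so the norm is the Hilbert space norm
  \<open>\<parallel>u\<parallel> = sqrt \<langle>u, u\<rangle>\<close>, and positive definiteness of the complex form is inherited.
  The complex form is linear in its first argument.
\<close>

class complex_inner_space = real_inner +
  fixes scaleC :: "complex \<Rightarrow> 'a \<Rightarrow> 'a"  (infixr \<open>*\<^sub>C\<close> 75)
    and cinner :: "'a \<Rightarrow> 'a \<Rightarrow> complex"
  assumes scaleC_add_right: "a *\<^sub>C (u + v) = a *\<^sub>C u + a *\<^sub>C v"
    and scaleC_add_left: "(a + b) *\<^sub>C u = a *\<^sub>C u + b *\<^sub>C u"
    and scaleC_scaleC: "a *\<^sub>C (b *\<^sub>C u) = (a * b) *\<^sub>C u"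
    and scaleC_of_real: "complex_of_real r *\<^sub>C u = r *\<^sub>R u"
    and cinner_commute: "cinner u v = cnj (cinner v u)"
    and cinner_add_left: "cinner (u + v) w = cinner u w + cinner v w"
    and cinner_scaleC_left: "cinner (a *\<^sub>C u) v = a * cinner u v"
    and inner_eq_Re_cinner: "inner u v = Re (cinner u v)"

class complex_hilbert_space = complex_inner_space + complete_space

instantiation complex :: complex_hilbert_space
begin

definition scaleC_complex :: "complex \<Rightarrow> complex \<Rightarrow> complex"
  where "scaleC_complex a u = a * u"

definition cinner_complex :: "complex \<Rightarrow> complex \<Rightarrow> complex"
  where "cinner_complex u v = u * cnj v"

instance
proof
  fix a b u v w :: complex and r :: real
  show "a *\<^sub>C (u + v) = a *\<^sub>C u + a *\<^sub>C v"
    and "(a + b) *\<^sub>C u = a *\<^sub>C u + b *\<^sub>C u"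
    and "cinner (u + v) w = cinner u w + cinner v w"
    by (simp_all add: scaleC_complex_def cinner_complex_def ring_distribs)
  show "a *\<^sub>C (b *\<^sub>C u) = (a * b) *\<^sub>C u"
    and "cinner u v = cnj (cinner v u)"
    and "cinner (a *\<^sub>C u) v = a * cinner u v"
    by (simp_all add: scaleC_complex_def cinner_complex_def mult_ac)
  show "complex_of_real r *\<^sub>C u = r *\<^sub>R u"
    unfolding scaleC_complex_def by (rule scaleR_conv_of_real[symmetric])
  show "inner u v = Re (cinner u v)"
    by (simp add: cinner_complex_def inner_complex_def)
qed

end

lemma scaleC_one: "1 *\<^sub>C u = u"
  using scaleC_of_real[of 1 u] by simp

lemma norm_eq_sqrt_cinner: "norm u = sqrt (Re (cinner u u))"
  unfolding norm_eq_sqrt_inner inner_eq_Re_cinner ..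

lemma cinner_self: "cinner u u = complex_of_real ((norm u)\<^sup>2)"
proof -
  have "Im (cinner u u) = Im (cnj (cinner u u))"
    by (rule arg_cong[OF cinner_commute])
  then have "Im (cinner u u) = 0"
    unfolding cnj.simps by linarith
  moreover have "Re (cinner u u) = (norm u)\<^sup>2"
    unfolding power2_norm_eq_inner inner_eq_Re_cinner ..
  ultimately show ?thesis
    by (intro complex_eqI) (simp_all only: Re_complex_of_real Im_complex_of_real)
qed

text \<open>
  Boundedness is part of the notion because \<^const>\<open>onorm\<close> is a supremum of reals and
  is meaningful only for bounded operators.
\<close>

definition bounded_clinear :: "('a::complex_inner_space \<Rightarrow> 'b::complex_inner_space) \<Rightarrow> bool"
  where "bounded_clinear T \<longleftrightarrow> bounded_linear T \<and> (\<forall>a u. T (a *\<^sub>C u) = a *\<^sub>C T u)"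

text \<open>The library's \<^const>\<open>adjoint\<close> refers to the real inner product.\<close>

definition cadjoint ::
    "('a::complex_inner_space \<Rightarrow> 'b::complex_inner_space) \<Rightarrow> 'b \<Rightarrow> 'a"
  where "cadjoint T = (THE S. \<forall>u v. cinner (T u) v = cinner u (S v))"

lemma cadjoint_eqI:
  assumes S: "\<And>u v. cinner (T u) v = cinner u (S v)"
  shows "cadjoint T = S"
  unfolding cadjoint_def
proof (rule the_equality)
  show "\<forall>u v. cinner (T u) v = cinner u (S v)"
    using S by (intro allI)
next
  fix S' assume S': "\<forall>u v. cinner (T u) v = cinner u (S' v)"
  show "S' = S"
  proof
    fix v
    have "inner u (S' v) = inner u (S v)" for u
    proof -
      have "cinner u (S' v) = cinner u (S v)"
        by (rule trans[OF S'[rule_format, symmetric] S])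
      then show ?thesis
        unfolding inner_eq_Re_cinner by (rule arg_cong)
    qed
    then show "S' v = S v"
      by (rule iffD1[OF vector_eq_ldot, OF allI])
  qed
qed

definition orbit_sum :: "('a::comm_monoid_add \<Rightarrow> 'a) \<Rightarrow> nat \<Rightarrow> 'a \<Rightarrow> 'a"
  where "orbit_sum T n x = (\<Sum>i<n. (T ^^ i) x)"

end

theory Submission
  imports Defs
begin

text \<open>
  Write \<open>A\<close> for the adjoint of \<open>T\<close> and put \<open>w = (\<Sum>k. A\<^sup>k x)\<close>, so that \<open>A w = w - x\<close>. Expanding
  \<open>S\<^bsub>n+1\<^esub> = x + T S\<^sub>n\<close> gives
  \<open>\<parallel>S\<^sub>N\<parallel>\<^sup>2 = (\<Sum>n<N. \<Sum>k\<le>n. \<beta>\<^sub>k) - (\<Sum>n<N. d\<^sub>n)\<close> with \<open>d\<^sub>n = \<parallel>S\<^sub>n\<parallel>\<^sup>2 - \<parallel>T S\<^sub>n\<parallel>\<^sup>2\<close>,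
  \<open>\<beta>\<^sub>0 = \<parallel>x\<parallel>\<^sup>2\<close> and \<open>\<beta>\<^sub>k = 2 Re \<langle>x, A\<^sup>k x\<rangle>\<close> for \<open>k \<ge> 1\<close>. After division by \<open>N\<close> the left side
  tends to 0 by the growth hypothesis, the averages of \<open>d\<^sub>n\<close> tend to 0 by Kronecker's lemma, and
  the remaining term tends to \<open>(\<Sum>k. \<beta>\<^sub>k) = \<parallel>w\<parallel>\<^sup>2 - \<parallel>A w\<parallel>\<^sup>2\<close>. Hence \<open>\<parallel>A w\<parallel> = \<parallel>w\<parallel>\<close>, which for a
  contraction forces \<open>T (A w) = w\<close>, and \<open>y = - A w\<close> is the required vector.
\<close>

text \<open>If \<open>f\<close> is \<open>inner _ s\<close>, then \<open>g v\<close> is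
  \<open>norm (v - s)\<close> squared minus \<open>norm s\<close> squared, so the representing
  vector is sought as a minimizer of \<open>g\<close>. It gives the existence of adjoints.\<close>

lemma Riesz_representation:
  fixes f :: "'a::{real_inner,banach} \<Rightarrow> real"
  assumes "bounded_linear f"
  shows "\<exists>s. \<forall>u. f u = inner u s"
proof -
  interpret f: bounded_linear f by fact
  define g where "g v = (norm v)\<^sup>2 - 2 * f v" for v
  obtain K where K: "\<And>v. norm (f v) \<le> norm v * K"
    using f.bounded by blast
  have "- K\<^sup>2 \<le> g v" for v
  proof -
    have "f v \<le> norm v * K" using K[of v] by simp
    moreover have "0 \<le> (norm v - K)\<^sup>2" by simp
    ultimately show ?thesis by (simp add: g_def power2_eq_square algebra_simps)
  qed
  then have bdd: "bdd_below (range g)" by (auto intro!: bdd_belowI)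
  define m where "m = Inf (range g)"
  have m_le: "m \<le> g v" for v
    unfolding m_def by (rule cInf_lower) (auto intro: bdd)
  have "\<exists>v. g v < m + inverse (real (Suc n))" for n
    using cInf_lessD[of "range g" "m + inverse (real (Suc n))"] by (auto simp: m_def)
  then obtain v where v: "\<And>n. g (v n) < m + inverse (real (Suc n))" by metis
  \<comment> \<open>In the parallelogram law for \<open>g\<close> the linear terms cancel; bounding
    \<open>g\<close> at the midpoint below by \<open>m\<close> makes a minimizing sequence
    Cauchy.\<close>
  have par: "(norm (a - b))\<^sup>2 \<le> 2 * (g a - m) + 2 * (g b - m)" for a b
  proof -
    have "(norm (a - b))\<^sup>2 + (norm (a + b))\<^sup>2 = 2 * (norm a)\<^sup>2 + 2 * (norm b)\<^sup>2"
      by (simp add: power2_norm_eq_inner inner_simps)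
    moreover have "g ((1/2) *\<^sub>R (a + b)) = (norm (a + b))\<^sup>2 / 4 - (f a + f b)"
      by (simp add: g_def f.scaleR f.add power_divide add_divide_distrib del: scaleR_add_right)
    ultimately have "(norm (a - b))\<^sup>2 = 2 * g a + 2 * g b - 4 * g ((1/2) *\<^sub>R (a + b))"
      by (simp add: g_def)
    then show ?thesis using m_le[of "(1/2) *\<^sub>R (a + b)"] by simp
  qed
  have "Cauchy v"
  proof (rule CauchyI)
    fix e :: real assume e: "0 < e"
    then obtain M where M: "inverse (real (Suc M)) < e\<^sup>2 / 4"
      using reals_Archimedean[of "e\<^sup>2 / 4"] by auto
    have "norm (v i - v j) < e" if "M \<le> i" "M \<le> j" for i j
    proof -
      have g_less: "g (v k) - m < e\<^sup>2 / 4" if "M \<le> k" for k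
      proof -
        have "inverse (real (Suc k)) \<le> inverse (real (Suc M))" using that by simp
        with v[of k] M show ?thesis by argo
      qed
      have "(norm (v i - v j))\<^sup>2 < e\<^sup>2"
        using par[of "v i" "v j"] g_less[OF \<open>M \<le> i\<close>] g_less[OF \<open>M \<le> j\<close>] by argo
      then show ?thesis using e by (simp add: power_less_imp_less_base)
    qed
    then show "\<exists>M. \<forall>i\<ge>M. \<forall>j\<ge>M. norm (v i - v j) < e" by blast
  qed
  then obtain s where s: "v \<longlonglongrightarrow> s" using Cauchy_convergent convergent_def by blast
  have "(\<lambda>n. g (v n)) \<longlonglongrightarrow> g s"
    unfolding g_def by (intro tendsto_intros f.tendsto s)
  moreover have "(\<lambda>n. m + inverse (real (Suc n))) \<longlonglongrightarrow> m + 0"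
    by (intro tendsto_intros LIMSEQ_inverse_real_of_nat)
  ultimately have gs: "g s \<le> m"
    using v by (intro LIMSEQ_le[of "\<lambda>n. g (v n)" "g s" "\<lambda>n. m + inverse (real (Suc n))" m])
      (auto intro: less_imp_le)
  have "f u = inner u s" for u
  proof (cases "u = 0")
    case False
    define r where "r = inner u s - f u"
    \<comment> \<open>This \<open>t\<close> minimizes the quadratic by which \<open>g\<close>
      changes along \<open>u\<close>; its minimal value is negative unless
      \<open>r = 0\<close>.\<close>
    define t where "t = - r / (norm u)\<^sup>2"
    have pos: "(norm u)\<^sup>2 > 0" using False by simp
    have "(norm (s + t *\<^sub>R u))\<^sup>2 = (norm s)\<^sup>2 + 2 * t * inner u s + t\<^sup>2 * (norm u)\<^sup>2"
      unfolding power2_norm_eq_inner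
      by (simp add: inner_simps inner_commute[of s u] power2_eq_square distrib_left)
    then have "g (s + t *\<^sub>R u) = g s + 2 * t * r + t\<^sup>2 * (norm u)\<^sup>2"
      by (simp add: g_def f.scaleR f.add r_def algebra_simps)
    then have "0 \<le> 2 * t * r + t\<^sup>2 * (norm u)\<^sup>2"
      using m_le[of "s + t *\<^sub>R u"] gs by linarith
    also have "\<dots> = - (r\<^sup>2 / (norm u)\<^sup>2)"
      using pos by (simp add: t_def power2_eq_square field_simps)
    finally have "r = 0" using pos by (simp add: divide_le_0_iff)
    then show ?thesis by (simp add: r_def)
  qed (simp add: f.zero)
  then show ?thesis by blast
qed

instance complex_hilbert_space \<subseteq> banach ..

text \<open>Multiplying by \<open>\<i>\<close> turns the imaginary part into a real part, so real
  adjoint identities lift to \<open>cinner\<close> once \<open>T\<close> commutes with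
  \<open>\<i>\<close>.\<close>

lemma cinner_eq_inner:
  fixes u v :: "'a::complex_inner_space"
  shows "cinner u v = Complex (inner u v) (- inner (\<i> *\<^sub>C u) v)"
  by (rule complex_eqI) (simp_all add: inner_eq_Re_cinner cinner_scaleC_left)

text \<open>\<open>cadjoint\<close> is a definite description, so an adjoint must first be produced:
  Riesz, applied to \<open>inner (T u) v\<close> as a functional of \<open>u\<close>, supplies
  it.\<close>

lemma cinner_cadjoint:
  fixes T :: "'a::complex_hilbert_space \<Rightarrow> 'b::complex_inner_space"
  assumes "bounded_clinear T"
  shows "cinner (T u) v = cinner u (cadjoint T v)"
proof -
  have T: "bounded_linear T" and TC: "\<And>a u. T (a *\<^sub>C u) = a *\<^sub>C T u"
    using assms by (auto simp: bounded_clinear_def)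
  have "\<exists>s. \<forall>u. inner (T u) v = inner u s" for v
    by (rule Riesz_representation) (intro bounded_linear_compose[OF bounded_linear_inner_left T])
  then obtain S where S: "\<And>u v. inner (T u) v = inner u (S v)" by metis
  have *: "cinner (T u) v = cinner u (S v)" for u v
    by (simp add: cinner_eq_inner TC[symmetric] S)
  then show ?thesis using cadjoint_eqI[of T S] by metis
qed

lemma inner_cadjoint:
  fixes T :: "'a::complex_hilbert_space \<Rightarrow> 'b::complex_inner_space"
  assumes "bounded_clinear T"
  shows "inner (T u) v = inner u (cadjoint T v)"
  by (simp add: inner_eq_Re_cinner cinner_cadjoint[OF assms])

lemma norm_adjoint_le:
  fixes T :: "'a::real_inner \<Rightarrow> 'b::real_inner"
  assumes "\<And>u v. inner (T u) v = inner u (A v)" and "\<And>u. norm (T u) \<le> norm u"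
  shows "norm (A v) \<le> norm v"
proof -
  have "norm (A v) * norm (A v) = inner (T (A v)) v"
    by (simp add: assms(1) flip: power2_norm_eq_inner power2_eq_square)
  also have "\<dots> \<le> norm (T (A v)) * norm v"
    by (rule norm_cauchy_schwarz)
  also have "\<dots> \<le> norm (A v) * norm v"
    by (intro mult_right_mono assms(2) norm_ge_zero)
  finally show ?thesis
    by (cases "norm (A v) = 0") (auto simp: mult_le_cancel_left)
qed

lemma bounded_linear_contractive_adjoint:
  fixes T :: "'a::real_inner \<Rightarrow> 'b::real_inner"
  assumes adj: "\<And>u v. inner (T u) v = inner u (A v)" and "\<And>u. norm (T u) \<le> norm u"
  shows "bounded_linear A"
proof (rule bounded_linear_intro[where K = 1])
  show "A (v + w) = A v + A w" for v w
    using vector_eq_ldot[of "A (v + w)" "A v + A w"]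
    by (simp add: inner_add_right flip: adj)
  show "A (r *\<^sub>R v) = r *\<^sub>R A v" for r v
    using vector_eq_ldot[of "A (r *\<^sub>R v)" "r *\<^sub>R A v"]
    by (simp flip: adj)
  show "norm (A v) \<le> norm v * 1" for v
    using norm_adjoint_le[OF assms] by simp
qed

text \<open>The cross term in the expanded square of \<open>norm (T (A w) - w)\<close> is twice the
  square of \<open>norm (A w)\<close>, so the equality of norms leaves a nonpositive
  quantity.\<close>

lemma contraction_adjoint_norm_eq:
  fixes T :: "'a::real_inner \<Rightarrow> 'b::real_inner"
  assumes adj: "\<And>u v. inner (T u) v = inner u (A v)" and contr: "\<And>u. norm (T u) \<le> norm u"
    and eq: "norm (A w) = norm w"
  shows "T (A w) = w"
proof -
  have "(norm (T (A w) - w))\<^sup>2 = (norm (T (A w)))\<^sup>2 - 2 * inner (T (A w)) w + (norm w)\<^sup>2"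
    by (simp add: power2_norm_eq_inner inner_simps inner_commute)
  also have "\<dots> = (norm (T (A w)))\<^sup>2 - (norm w)\<^sup>2"
    by (simp add: adj eq flip: power2_norm_eq_inner)
  also have "\<dots> \<le> 0"
    using contr[of "A w"] by (simp add: eq power_mono)
  finally show ?thesis by simp
qed

text \<open>Dominated convergence for series: each fixed term tends to 0, and \<open>k < n\<close>
  bounds it by \<open>\<bar>b k\<bar>\<close>.\<close>

lemma Kronecker_lemma:
  fixes b :: "nat \<Rightarrow> real"
  assumes "summable (\<lambda>k. \<bar>b k\<bar>)"
  shows "(\<lambda>n. (\<Sum>k<n. real k * b k) / real n) \<longlonglongrightarrow> 0"
proof -
  define a where "a k n = (if k < n then real k * b k / real n else 0)" for k n
  have "(\<lambda>n. a k n) \<longlonglongrightarrow> 0" for k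
  proof (rule Lim_transform_eventually)
    show "(\<lambda>n. real k * b k / real n) \<longlonglongrightarrow> 0" by (rule lim_const_over_n)
    show "\<forall>\<^sub>F n in sequentially. real k * b k / real n = a k n"
      using eventually_gt_at_top[of k] by eventually_elim (simp add: a_def)
  qed
  moreover have "norm (a k n) \<le> \<bar>b k\<bar>" for k n
    by (auto simp: a_def abs_mult divide_le_eq mult.commute[of "real k"] intro: mult_left_mono)
  ultimately have "(\<lambda>n. suminf (\<lambda>k. a k n)) \<longlonglongrightarrow> (\<Sum>k. 0)"
    using assms tannerys_theorem[of a "\<lambda>k. 0" sequentially "\<lambda>k. \<bar>b k\<bar>"] by (auto simp: case_prod_unfold)
  moreover have "suminf (\<lambda>k. a k n) = (\<Sum>k<n. real k * b k) / real n" for n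
    by (subst suminf_finite[of "{..<n}"]) (auto simp: a_def sum_divide_distrib)
  ultimately show ?thesis by simp
qed

text \<open>\<open>b k\<close> occurs in \<open>N - k\<close> of the inner sums. After division by
  \<open>N\<close>, the correction is an average of the kind in Kronecker's lemma.\<close>

lemma sum_partial_sums:
  fixes b :: "nat \<Rightarrow> 'a::comm_ring_1"
  shows "(\<Sum>n<N. \<Sum>k\<le>n. b k) = of_nat N * (\<Sum>k<N. b k) - (\<Sum>k<N. of_nat k * b k)"
  by (induction N) (simp_all add: algebra_simps flip: lessThan_Suc_atMost)

lemma orbit_sum_Suc:
  assumes "linear T"
  shows "orbit_sum T (Suc n) x = x + T (orbit_sum T n x)"
  unfolding orbit_sum_def linear_sum[OF assms] by (subst sum.lessThan_Suc_shift) simp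

lemma inner_funpow_adjoint:
  fixes T A :: "'a::real_inner \<Rightarrow> 'a"
  assumes "\<And>u v. inner (T u) v = inner u (A v)"
  shows "inner ((T ^^ k) u) v = inner u ((A ^^ k) v)"
  by (induction k arbitrary: v) (simp_all add: assms funpow_swap1[of A])

lemma norm_orbit_sum_squared:
  fixes T :: "'a::real_inner \<Rightarrow> 'a" and x :: 'a
  defines "\<beta> \<equiv> \<lambda>k. if k = 0 then (norm x)\<^sup>2 else 2 * inner x ((T ^^ k) x)"
  assumes "linear T"
  shows "(norm (orbit_sum T N x))\<^sup>2 = (\<Sum>n<N. \<Sum>k\<le>n. \<beta> k)
    - (\<Sum>n<N. (norm (orbit_sum T n x))\<^sup>2 - (norm (T (orbit_sum T n x)))\<^sup>2)"
proof (induction N)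
  case (Suc N)
  have "(norm (orbit_sum T (Suc N) x))\<^sup>2
      = (norm x)\<^sup>2 + 2 * inner x (T (orbit_sum T N x)) + (norm (T (orbit_sum T N x)))\<^sup>2"
    unfolding orbit_sum_Suc[OF assms(2)]
    by (simp add: power2_norm_eq_inner inner_simps inner_commute)
  \<comment> \<open>\<open>T\<close> shifts the orbit sum to the powers 1 to \<open>N\<close>, so
    the cross term supplies exactly the \<beta> of positive index.\<close>
  moreover have "(norm x)\<^sup>2 + 2 * inner x (T (orbit_sum T N x)) = (\<Sum>k\<le>N. \<beta> k)"
    unfolding lessThan_Suc_atMost[symmetric] sum.lessThan_Suc_shift orbit_sum_def
      linear_sum[OF assms(2)]
    by (simp add: \<beta>_def inner_sum_right sum_distrib_left)
  ultimately show ?case using Suc by simp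
qed (simp add: orbit_sum_def)

text \<open>The argument takes place in a real Hilbert space, where \<open>inner\<close> and an
  adjoint for it suffice.\<close>

lemma exists_isometric_coboundary:
  fixes T A :: "'a::{real_inner,banach} \<Rightarrow> 'a" and x :: 'a
  assumes "linear T" and contr: "\<And>u. norm (T u) \<le> norm u"
    and adj: "\<And>u v. inner (T u) v = inner u (A v)"
    and sm: "summable (\<lambda>k. norm ((A ^^ k) x))"
    and growth: "(\<lambda>n. norm (orbit_sum T n x)) \<in> o(\<lambda>n. sqrt (real n))"
    and defect: "summable (\<lambda>k. ((norm (orbit_sum T k x))\<^sup>2 - (norm (T (orbit_sum T k x)))\<^sup>2) / real k)"
  shows "\<exists>y. x = y - T y \<and> norm (T y) = norm y"
proof -
  interpret A: bounded_linear A
    by (rule bounded_linear_contractive_adjoint[OF adj contr])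
  define w where "w = (\<Sum>k. (A ^^ k) x)"
  have smA: "summable (\<lambda>k. (A ^^ k) x)" by (rule summable_norm_cancel[OF sm])
  have Aw: "A w = w - x"
    using A.suminf[OF smA] suminf_split_head[OF smA] by (simp add: w_def)
  define q where "q n = (norm (orbit_sum T n x))\<^sup>2" for n
  define b where "b k = (q k - (norm (T (orbit_sum T k x)))\<^sup>2) / real k" for k
  define \<beta> where "\<beta> k = (if k = 0 then (norm x)\<^sup>2 else 2 * inner x ((T ^^ k) x))" for k
  \<comment> \<open>Moving the powers onto \<open>A\<close> makes \<beta> summable; the subtracted
    term corrects the doubling at \<open>k = 0\<close>.\<close>
  have \<beta>: "\<beta> k = 2 * inner x ((A ^^ k) x) - (if k = 0 then (norm x)\<^sup>2 else 0)" for k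
    using inner_funpow_adjoint[OF adj, of k x x]
    by (simp add: \<beta>_def inner_commute power2_norm_eq_inner)
  have "(\<lambda>k. inner x ((A ^^ k) x)) sums inner x w"
    unfolding w_def by (intro bounded_linear.sums[OF bounded_linear_inner_right] summable_sums smA)
  then have \<beta>_sums: "\<beta> sums (2 * inner x w - (norm x)\<^sup>2)"
    unfolding \<beta> by (intro sums_diff sums_mult sums_single)
  have "summable (\<lambda>k. \<bar>inner x ((A ^^ k) x)\<bar>)"
  proof (rule summable_comparison_test')
    show "summable (\<lambda>k. norm x * norm ((A ^^ k) x))" by (intro summable_mult sm)
    show "norm \<bar>inner x ((A ^^ k) x)\<bar> \<le> norm x * norm ((A ^^ k) x)" for k
      by (simp add: Cauchy_Schwarz_ineq2)
  qed
  then have "summable (\<lambda>k. 2 * \<bar>inner x ((A ^^ k) x)\<bar> + (if k = 0 then (norm x)\<^sup>2 else 0))"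
    by (intro summable_add summable_mult sums_summable[OF sums_single])
  then have \<beta>_abs: "summable (\<lambda>k. \<bar>\<beta> k\<bar>)"
    by (rule summable_comparison_test'[where N = 0]) (simp add: \<beta> abs_mult power2_norm_eq_inner)
  \<comment> \<open>Contractivity makes the defects nonnegative, which upgrades their convergence to
    the absolute convergence required for Kronecker's lemma.\<close>
  have b_nonneg: "0 \<le> b k" for k
    by (simp add: b_def q_def contr power_mono)
  have b_abs: "summable (\<lambda>k. \<bar>b k\<bar>)"
    unfolding abs_of_nonneg[OF b_nonneg] using defect by (simp add: b_def q_def)
  \<comment> \<open>At \<open>k = 0\<close>, \<open>b\<close> is 0 by division by zero, and the
    defect of the empty orbit sum also vanishes.\<close>
  have kb: "q k - (norm (T (orbit_sum T k x)))\<^sup>2 = real k * b k" for k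
    using linear_0[OF assms(1)] by (cases "k = 0") (simp_all add: b_def q_def orbit_sum_def)
  have q_div: "q N / real N = (\<Sum>k<N. \<beta> k) - (\<Sum>k<N. real k * \<beta> k) / real N
      - (\<Sum>k<N. real k * b k) / real N" if "N > 0" for N
    using that norm_orbit_sum_squared[OF assms(1), of N x, folded \<beta>_def]
    by (simp add: sum_partial_sums kb diff_divide_distrib flip: q_def)
  have "(\<lambda>N. (\<Sum>k<N. \<beta> k) - (\<Sum>k<N. real k * \<beta> k) / real N - (\<Sum>k<N. real k * b k) / real N)
      \<longlonglongrightarrow> (2 * inner x w - (norm x)\<^sup>2) - 0 - 0"
    using \<beta>_sums by (intro tendsto_diff Kronecker_lemma \<beta>_abs b_abs) (simp add: sums_def)
  then have lim: "(\<lambda>N. q N / real N) \<longlonglongrightarrow> 2 * inner x w - (norm x)\<^sup>2"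
    by (rule Lim_transform_eventually[OF tendsto_eq_rhs])
      (auto intro!: eventually_sequentiallyI[of 1] simp: q_div)
  have "(\<lambda>n. norm (orbit_sum T n x) / sqrt (real n)) \<longlonglongrightarrow> 0"
    by (rule smalloD_tendsto[OF growth])
  then have "(\<lambda>n. (norm (orbit_sum T n x) / sqrt (real n))\<^sup>2) \<longlonglongrightarrow> 0\<^sup>2"
    by (intro tendsto_power)
  then have "(\<lambda>N. q N / real N) \<longlonglongrightarrow> 0" by (simp add: q_def power_divide)
  with lim have zero: "2 * inner x w = (norm x)\<^sup>2"
    using LIMSEQ_unique by fastforce
  \<comment> \<open>With \<open>A w = w - x\<close>, the limit just shown to be 0 is the difference
    of the squared norms of \<open>w\<close> and \<open>A w\<close>.\<close>
  have "(norm (A w))\<^sup>2 = (norm w)\<^sup>2 - 2 * inner x w + (norm x)\<^sup>2"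
    by (simp add: Aw power2_norm_eq_inner inner_simps inner_commute)
  then have norm_Aw: "norm (A w) = norm w" using zero by simp
  then have TAw: "T (A w) = w" by (rule contraction_adjoint_norm_eq[OF adj contr])
  have "T (- A w) = - w" using linear_neg[OF assms(1)] by (simp add: TAw)
  then show ?thesis
    by (intro exI[of _ "- A w"]) (use norm_Aw in \<open>simp add: Aw norm_minus_commute\<close>)
qed

theorem corollary1p6:
  fixes T :: "'a::complex_hilbert_space \<Rightarrow> 'a" and x :: 'a
  assumes "bounded_clinear T"
    and "onorm T \<le> 1"
    and "summable (\<lambda>k. real k * norm ((cadjoint T ^^ k) x))"
    and "(\<lambda>n. norm (orbit_sum T n x)) \<in> o(\<lambda>n. sqrt (real n))"
    and "summable (\<lambda>k. ((norm (orbit_sum T (Suc k) x))\<^sup>2 - (norm (T (orbit_sum T (Suc k) x)))\<^sup>2)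
                        / real (Suc k))"
  shows "\<exists>y. x = y - T y \<and> norm (T y) = norm y"
proof (rule exists_isometric_coboundary)
  have T: "bounded_linear T" using assms(1) by (simp add: bounded_clinear_def)
  then show "linear T" by (rule bounded_linear.linear)
  show "norm (T u) \<le> norm u" for u
    using onorm[OF T, of u] mult_right_mono[OF assms(2) norm_ge_zero[of u]] by simp
  show "inner (T u) v = inner u (cadjoint T v)" for u v
    by (rule inner_cadjoint[OF assms(1)])
  show "summable (\<lambda>k. norm ((cadjoint T ^^ k) x))"
    \<comment> \<open>From index 1 on the weight \<open>real k\<close> is at least 1.\<close>
    by (rule summable_comparison_test'[OF assms(3), where N = 1])
      (simp add: mult_le_cancel_right1)
  show "summable (\<lambda>k. ((norm (orbit_sum T k x))\<^sup>2 - (norm (T (orbit_sum T k x)))\<^sup>2) / real k)"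
    by (subst summable_Suc_iff[symmetric]) (rule assms(5))
qed (rule assms(4))

end
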